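(* Let $X=Q_x\widetilde X\in\mathbb{R}^{m\times n}$ and $Y=Q_y\widetilde Y\in\mathbb{R}^{m\times n}$, where $Q_x\in\mathbb{R}^{m\times r_x}$ and $Q_y\in\mathbb{R}^{m\times r_y}$ have orthonormal columns and $\widetilde X\in\mathbb{R}^{r_x\times n}$, $\widetilde Y\in\mathbb{R}^{r_y\times n}$ have full row rank. Let $\widetilde X=T\widetilde Q^T$ be an orthogonal factorization with $\widetilde Q\in\mathbb{R}^{n\times r_x}$, $\widetilde Q^T\widetilde Q=I$, and $T\in\mathbb{R}^{r_x\times r_x}$ either upper triangular (RQ case) or lower triangular (LQ case), and let $G_{y,q}=\widetilde Y\widetilde Q$. Let $\mathbf{x}_{new},\mathbf{y}_{new}\in\mathbb{R}^m$, $X_{new}=(X\;\;\mathbf{x}_{new})$, $Y_{new}=(Y\;\;\mathbf{y}_{new})$, and let $g_x,\gamma_x,g_y,\gamma_y$ and the low rank factors $\widetilde X_{new},\widetilde Y_{new}$ of $X_{new},Y_{new}$ be as defined in the context. Let $r\in\{r_x,r_x+1\}$ be the rank of $X_{new}$. Then there is an $(r_x+1)\times(r_x+1)$ matrix $U_G$ that is a product of $r_x$ Givens rotation matrices, where in the RQ case with $\gamma_x>0$ one can take $U_G=I_{r_x+1}$, such that, with $$T_{new}=\begin{cases}\begin{pmatrix}T&g_x\\ \mathbf{0}&\gamma_x\end{pmatrix}U_G(:,1:r),&\gamma_x>0,\\[2mm] \begin{pmatrix}T&g_x\end{pmatrix}U_G(:,1:r),&\gamma_x=0,\end{cases}\qquad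 G_{y,q}^{(new)}=\begin{cases}\begin{pmatrix}G_{y,q}&g_y\\ \mathbf{0}&\gamma_y\end{pmatrix}U_G(:,1:r),&\gamma_y>0,\\[2mm] \begin{pmatrix}G_{y,q}&g_y\end{pmatrix}U_G(:,1:r),&\gamma_y=0,\end{cases}$$ the matrix $T_{new}$ is an $r\times r$ triangular matrix of the same type (upper or lower) as $T$, there is a matrix $\widetilde Q_{new}\in\mathbb{R}^{(n+1)\times r}$ with orthonormal columns such that $\widetilde X_{new}=T_{new}\widetilde Q_{new}^T$, and $G_{y,q}^{(new)}=\widetilde Y_{new}\widetilde Q_{new}$.
   Context: Submatrix notation is Matlab-like: $U(:,1:r)$ denotes the first $r$ columns of $U$. A Givens rotation matrix is a plane rotation acting on two coordinates. Update of the low rank factors by Gram–Schmidt: $g_x=Q_x^T\mathbf{x}_{new}$ and $\gamma_x=\|\mathbf{x}_{new}-Q_xg_x\|_2$. If $\gamma_x>0$, then $q_{x,new}=(\mathbf{x}_{new}-Q_xg_x)/\gamma_x$, $Q_{x,new}=(Q_x\;\;q_{x,new})$ and $\widetilde X_{new}=\begin{pmatrix}\widetilde X&g_x\\ \mathbf{0}&\gamma_x\end{pmatrix}$. If $\gamma_x=0$, then $Q_{x,new}=Q_x$ and $\widetilde X_{new}=(\widetilde X\;\;g_x)$. In both cases $X_{new}=Q_{x,new}\widetilde X_{new}$. The objects $g_y,\gamma_y,Q_{y,new},\widetilde Y_{new}$ are defined in the same way from $Q_y,\widetilde Y,\mathbf{y}_{new}$. *)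

theory Defs
  imports Complex_Main "Jordan_Normal_Form.DL_Rank"
begin

definition orthonormal_cols :: "real mat \<Rightarrow> bool" where
  "orthonormal_cols Q \<longleftrightarrow> Q\<^sup>T * Q = 1\<^sub>m (dim_col Q)"

definition full_row_rank :: "real mat \<Rightarrow> bool" where
  "full_row_rank A \<longleftrightarrow> vec_space.rank (dim_row A) A = dim_row A"

definition norm2 :: "real vec \<Rightarrow> real" where
  "norm2 v = sqrt (v \<bullet> v)"

definition append_col :: "real mat \<Rightarrow> real vec \<Rightarrow> real mat" where
  "append_col A v = mat_of_cols (dim_row A) (cols A @ [v])"

definition first_cols :: "real mat \<Rightarrow> nat \<Rightarrow> real mat" where
  "first_cols A k = mat_of_cols (dim_row A) (take k (cols A))"

definition gs_coeffs :: "real mat \<Rightarrow> real vec \<Rightarrow> real vec" where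
  "gs_coeffs Q x = Q\<^sup>T *\<^sub>v x"

definition gs_dist :: "real mat \<Rightarrow> real vec \<Rightarrow> real" where
  "gs_dist Q x = norm2 (x - Q *\<^sub>v gs_coeffs Q x)"

(* The block matrix ((A, g), (0, \<gamma>)) if \<gamma> > 0, and (A, g) otherwise. With g = gs_coeffs Q x and
   \<gamma> = gs_dist Q x it is the updated low rank factor when A is the old one; the updates of
   T and of G_{y,q} are this same matrix times leading columns of U_G. *)
definition border :: "real mat \<Rightarrow> real vec \<Rightarrow> real \<Rightarrow> real mat" where
  "border A g \<gamma> =
     (if \<gamma> > 0
      then four_block_mat A (mat_of_cols (dim_row A) [g]) (0\<^sub>m 1 (dim_col A)) (mat 1 1 (\<lambda>_. \<gamma>))
      else append_col A g)"

(* The plane rotation acting on coordinates i and j, where c and s are the cosine and sine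
   of the angle. *)
definition givens_mat :: "nat \<Rightarrow> nat \<Rightarrow> nat \<Rightarrow> real \<Rightarrow> real \<Rightarrow> real mat" where
  "givens_mat N i j c s = mat N N (\<lambda>(k, l).
     if k = l then (if k = i \<or> k = j then c else 1)
     else if k = i \<and> l = j then s
     else if k = j \<and> l = i then - s
     else 0)"

(* i < j loses no generality because the sign of s is free. The trivial rotation c = 1, s = 0
   is included. *)
definition is_givens :: "nat \<Rightarrow> real mat \<Rightarrow> bool" where
  "is_givens N G \<longleftrightarrow>
     (\<exists>i j c s. i < j \<and> j < N \<and> c\<^sup>2 + s\<^sup>2 = 1 \<and> G = givens_mat N i j c s)"

definition givens_product :: "nat \<Rightarrow> nat \<Rightarrow> real mat \<Rightarrow> bool" where
  "givens_product N k U \<longleftrightarrow>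
     (\<exists>Gs. length Gs = k \<and> (\<forall>G \<in> set Gs. is_givens N G) \<and> U = foldr (*) Gs (1\<^sub>m N))"

definition lower_triangular :: "real mat \<Rightarrow> bool" where
  "lower_triangular A \<longleftrightarrow> (\<forall>j < dim_col A. \<forall>i < j. A $$ (i, j) = 0)"

datatype fact_type = RQ | LQ

fun triangular :: "fact_type \<Rightarrow> real mat \<Rightarrow> bool" where
  "triangular RQ A = upper_triangular A"
| "triangular LQ A = lower_triangular A"

end

theory Submission
  imports Defs
begin

text \<open>Write \<open>W = diag(Qt, 1)\<close>, which has orthonormal columns. Bordering commutes with right
  multiplication in the sense that the border of \<open>A * Q\<close> is the border of \<open>A\<close> times \<open>diag(Q, 1)\<close>,
  so \<open>Xtnew = B * W\<^sup>T\<close> and \<open>border G gy \<gamma>y = Ytnew * W\<close> with \<open>B = border T gx \<gamma>x\<close>. If \<open>U\<close> is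
  orthogonal and the columns of \<open>B * U\<close> from index \<open>r\<close> on vanish, then \<open>B = (B * U1) * U1\<^sup>T\<close> for the
  first \<open>r\<close> columns \<open>U1\<close> of \<open>U\<close>, and \<open>Qtnew = W * U1\<close> works. A suitable \<open>U\<close> annihilates the entries
  of the last column of \<open>B\<close> one at a time by rotating it against the other columns, from top to bottom
  in the LQ case and from bottom to top in the RQ case with \<open>\<gamma>x = 0\<close>; for \<open>\<gamma>x > 0\<close> an upper
  triangular \<open>T\<close> already gives an upper triangular \<open>B\<close>. The rank of \<open>Xnew\<close> is the number of columns
  of its Gram-Schmidt factor because the border of \<open>Xt\<close> has a right inverse.\<close>

section \<open>Products of Givens rotations and their orthogonality\<close>

lemma foldr_mat_mult_carrier:
  assumes "\<forall>G \<in> set Gs. G \<in> carrier_mat N N"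
  shows "foldr (*) Gs (1\<^sub>m N) \<in> carrier_mat N N"
  using assms by (induction Gs) auto

text \<open>The elimination multiplies each new rotation on the right, whereas \<open>foldr\<close>
  peels factors off on the left; associativity moves the last factor out.\<close>

lemma foldr_mat_mult_snoc:
  fixes H :: "'a :: semiring_1 mat"
  assumes "\<forall>G \<in> set Gs. G \<in> carrier_mat N N" and "H \<in> carrier_mat N N"
  shows "foldr (*) (Gs @ [H]) (1\<^sub>m N) = foldr (*) Gs (1\<^sub>m N) * H"
  using assms
proof (induction Gs)
  case (Cons G Gs)
  then show ?case
    using foldr_mat_mult_carrier[of Gs N] by (simp add: assoc_mult_mat[of G N N _ N H N])
qed (simp add: left_mult_one_mat[of H N N] right_mult_one_mat[of H N N])

lemma is_givens_carrier: "is_givens N G \<Longrightarrow> G \<in> carrier_mat N N"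
  by (auto simp: is_givens_def givens_mat_def)

lemma givens_product_carrier: "givens_product N k U \<Longrightarrow> U \<in> carrier_mat N N"
  using foldr_mat_mult_carrier is_givens_carrier unfolding givens_product_def by blast

lemma givens_product_0: "givens_product N 0 (1\<^sub>m N)"
  by (simp add: givens_product_def)

lemma givens_product_Suc:
  assumes "givens_product N k U" and "is_givens N G"
  shows "givens_product N (Suc k) (U * G)"
proof -
  obtain Gs where "length Gs = k" "\<forall>G \<in> set Gs. is_givens N G" "U = foldr (*) Gs (1\<^sub>m N)"
    using assms(1) by (auto simp: givens_product_def)
  with assms(2) show ?thesis
    unfolding givens_product_def
    by (intro exI[of _ "Gs @ [G]"]) (auto simp: is_givens_carrier foldr_mat_mult_snoc[of Gs N G, symmetric])
qed

text \<open>The number of factors is exact, so the identity has to be written with \<open>k\<close>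
  rotations by angle zero. These need two distinct coordinates, hence \<open>N > 1\<close> unless
  the product is empty.\<close>

lemma givens_product_one:
  assumes "k > 0 \<Longrightarrow> N > 1"
  shows "givens_product N k (1\<^sub>m N)"
proof (use assms in \<open>induction k\<close>)
  case 0
  show ?case by (rule givens_product_0)
next
  case (Suc k)
  then have "N > 1" by simp
  have "givens_mat N 0 1 1 0 = 1\<^sub>m N"
    by (rule eq_matI) (auto simp: givens_mat_def)
  with \<open>N > 1\<close> have "is_givens N (1\<^sub>m N)"
    unfolding is_givens_def by (intro exI[of _ 0] exI[of _ 1] exI[of _ "1::real"] exI[of _ "0::real"]) auto
  with Suc \<open>N > 1\<close> show ?case
    using givens_product_Suc[of N k "1\<^sub>m N" "1\<^sub>m N"] by simp
qed

lemma mult_givens_mat_index: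
  assumes B: "B \<in> carrier_mat p N" and ij: "i < j" "j < N" and kl: "k < p" "l < N"
  shows "(B * givens_mat N i j c s) $$ (k, l) =
    (if l = i then c * B $$ (k, i) - s * B $$ (k, j)
     else if l = j then s * B $$ (k, i) + c * B $$ (k, j)
     else B $$ (k, l))"
proof -
  have G: "givens_mat N i j c s \<in> carrier_mat N N" by (simp add: givens_mat_def)
  have "(B * givens_mat N i j c s) $$ (k, l) =
      (\<Sum>h \<in> {0..<N}. B $$ (k, h) * givens_mat N i j c s $$ (h, l))"
    using B kl G by (simp add: scalar_prod_def)
  \<comment> \<open>Column \<open>l\<close> of the rotation is supported on \<open>{i, j}\<close> if
    \<open>l\<close> is one of these indices and on \<open>{l}\<close> otherwise. Separating the
    three positions gives delta sums that collapse on their own.\<close>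
  also have "\<dots> = (\<Sum>h \<in> {0..<N}.
      (if h = i then (if l = i then c * B $$ (k, i) else if l = j then s * B $$ (k, i) else 0) else 0) +
      (if h = j then (if l = i then - s * B $$ (k, j) else if l = j then c * B $$ (k, j) else 0) else 0) +
      (if h = l then (if l \<noteq> i \<and> l \<noteq> j then B $$ (k, l) else 0) else 0))"
    using ij kl by (intro sum.cong) (auto simp: givens_mat_def)
  also have "\<dots> = (if l = i then c * B $$ (k, i) - s * B $$ (k, j)
     else if l = j then s * B $$ (k, i) + c * B $$ (k, j)
     else B $$ (k, l))"
    using ij kl by (simp add: sum.distrib)
  finally show ?thesis .
qed

lemma is_givens_orthogonal:
  assumes "is_givens N G"
  shows "G\<^sup>T * G = 1\<^sub>m N"
proof -
  obtain i j c s where ij: "i < j" "j < N" and cs: "c\<^sup>2 + s\<^sup>2 = 1" and G: "G = givens_mat N i j c s"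
    using assms by (auto simp: is_givens_def)
  have GT: "G\<^sup>T \<in> carrier_mat N N" by (simp add: G givens_mat_def)
  have [simp]: "c * c + s * s = 1" "s * s + c * c = 1"
    using cs by (auto simp: power2_eq_square)
  show ?thesis
  proof (rule eq_matI)
    fix k l assume "k < dim_row (1\<^sub>m N :: real mat)" "l < dim_col (1\<^sub>m N :: real mat)"
    then have kl: "k < N" "l < N" by auto
    show "(G\<^sup>T * G) $$ (k, l) = 1\<^sub>m N $$ (k, l)"
      \<comment> \<open>The left factor of the index formula is taken to be
        \<open>G\<^sup>T\<close>, so each entry of the product is an explicit expression in
        \<open>c\<close> and \<open>s\<close>.\<close>
      using mult_givens_mat_index[OF GT ij kl, of c s] ij kl
      unfolding G[symmetric] by (auto simp: G givens_mat_def)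
  qed (auto simp: G givens_mat_def)
qed

lemma foldr_mat_mult_orthogonal:
  fixes Gs :: "'a :: comm_semiring_1 mat list"
  assumes "\<forall>G \<in> set Gs. G \<in> carrier_mat N N \<and> G\<^sup>T * G = 1\<^sub>m N"
  shows "(foldr (*) Gs (1\<^sub>m N))\<^sup>T * foldr (*) Gs (1\<^sub>m N) = 1\<^sub>m N"
  using assms
proof (induction Gs)
  case (Cons G Gs)
  define P where "P = foldr (*) Gs (1\<^sub>m N)"
  have G: "G \<in> carrier_mat N N" "G\<^sup>T * G = 1\<^sub>m N" and P: "P \<in> carrier_mat N N" "P\<^sup>T * P = 1\<^sub>m N"
    using Cons foldr_mat_mult_carrier[of Gs N] by (auto simp: P_def)
  have "(G * P)\<^sup>T * (G * P) = P\<^sup>T * ((G\<^sup>T * G) * P)"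
    using G(1) P(1) by (simp add: transpose_mult[of G N N P N] assoc_mult_mat[of _ N N _ N _ N])
  then show ?case
    using G P by (simp add: P_def)
qed simp

lemma givens_product_orthogonal:
  assumes "givens_product N k U"
  shows "U\<^sup>T * U = 1\<^sub>m N" "U * U\<^sup>T = 1\<^sub>m N"
proof -
  show *: "U\<^sup>T * U = 1\<^sub>m N"
    using assms foldr_mat_mult_orthogonal[of _ N] is_givens_carrier is_givens_orthogonal
    unfolding givens_product_def by blast
  show "U * U\<^sup>T = 1\<^sub>m N"
    using mat_mult_left_right_inverse[OF _ _ *] givens_product_carrier[OF assms] by auto
qed

section \<open>Annihilating the last column by rotations\<close>

text \<open>The second equation is the vanishing of the entry in column \<open>j\<close> in
  \<open>mult_givens_mat_index\<close>. The solution is the normalised vector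
  \<open>(a, -b)\<close>, or the trivial rotation if both entries are zero.\<close>

lemma givens_annihilation:
  obtains c s :: real where "c\<^sup>2 + s\<^sup>2 = 1" "s * a + c * b = 0"
proof (cases "a = 0 \<and> b = 0")
  case True
  then show ?thesis using that[of 1 0] by simp
next
  case False
  define h where "h = sqrt (a\<^sup>2 + b\<^sup>2)"
  have "h\<^sup>2 = a\<^sup>2 + b\<^sup>2" "h \<noteq> 0"
    using False by (auto simp: h_def sum_power2_eq_zero_iff)
  then have "(a / h)\<^sup>2 + (- b / h)\<^sup>2 = 1" "(- b / h) * a + (a / h) * b = 0"
    by (auto simp: power_divide add_divide_distrib[symmetric])
  then show ?thesis by (rule that)
qed

text \<open>The numbering \<open>\<rho>\<close> is the order in which the entries of the last column are annihilated:
  the identity for a lower triangular matrix, the reversal for an upper triangular one.\<close>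

lemma givens_elimination:
  fixes B :: "real mat" and \<rho> :: "nat \<Rightarrow> nat"
  assumes B: "B \<in> carrier_mat p (k + 1)" and "k \<le> p"
    and inj: "inj_on \<rho> {..<p}" and onto: "{..<k} \<subseteq> \<rho> ` {..<k}"
    and tri: "\<And>i j. i < p \<Longrightarrow> j < k \<Longrightarrow> \<rho> i < \<rho> j \<Longrightarrow> B $$ (i, j) = 0"
  obtains U where "givens_product (k + 1) k U"
    and "\<And>i j. i < p \<Longrightarrow> j < k \<Longrightarrow> \<rho> i < \<rho> j \<Longrightarrow> (B * U) $$ (i, j) = 0"
    and "\<And>i. i < p \<Longrightarrow> \<rho> i < k \<Longrightarrow> (B * U) $$ (i, k) = 0"
proof -
  \<comment> \<open>Induction on the number \<open>t\<close> of annihilated entries, with the zero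
    pattern of the first \<open>k\<close> columns as part of the invariant.\<close>
  have "\<exists>U. givens_product (k + 1) t U \<and>
      (\<forall>i<p. \<forall>j<k. \<rho> i < \<rho> j \<longrightarrow> (B * U) $$ (i, j) = 0) \<and>
      (\<forall>i<p. \<rho> i < t \<longrightarrow> (B * U) $$ (i, k) = 0)" if "t \<le> k" for t
    using that
  proof (induction t)
    case 0
    show ?case
      using givens_product_0[of "k + 1"] B tri by (intro exI[of _ "1\<^sub>m (k + 1)"]) auto
  next
    case (Suc t)
    then obtain U where U: "givens_product (k + 1) t U"
      and cols: "\<And>i j. i < p \<Longrightarrow> j < k \<Longrightarrow> \<rho> i < \<rho> j \<Longrightarrow> (B * U) $$ (i, j) = 0"
      and last: "\<And>i. i < p \<Longrightarrow> \<rho> i < t \<Longrightarrow> (B * U) $$ (i, k) = 0"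
      by auto
    \<comment> \<open>Row \<open>h\<close> is next in the order. Its last entry is rotated against
      the entry in column \<open>h\<close>, the diagonal position, so only columns \<open>h\<close>
      and \<open>k\<close> change.\<close>
    obtain h where h: "h < k" "\<rho> h = t"
      using onto Suc.prems by (metis Suc_le_eq imageE lessThan_iff subset_eq)
    obtain c s where cs: "c\<^sup>2 + s\<^sup>2 = 1" "s * (B * U) $$ (h, h) + c * (B * U) $$ (h, k) = 0"
      by (rule givens_annihilation)
    define R where "R = givens_mat (k + 1) h k c s"
    have R: "is_givens (k + 1) R"
      unfolding is_givens_def R_def using h cs by auto
    have BU: "B * U \<in> carrier_mat p (k + 1)"
      using B givens_product_carrier[OF U] by simp
    have assoc: "B * (U * R) = B * U * R"
      using B givens_product_carrier[OF U] is_givens_carrier[OF R]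
      by (simp add: assoc_mult_mat[of B p "k + 1" U "k + 1" R "k + 1"])
    have idx: "(B * U * R) $$ (i, j) =
        (if j = h then c * (B * U) $$ (i, h) - s * (B * U) $$ (i, k)
         else if j = k then s * (B * U) $$ (i, h) + c * (B * U) $$ (i, k)
         else (B * U) $$ (i, j))" if "i < p" "j < k + 1" for i j
      unfolding R_def using mult_givens_mat_index[OF BU \<open>h < k\<close> _ that] by simp
    show ?case
    proof (intro exI[of _ "U * R"] conjI allI impI)
      show "givens_product (k + 1) (Suc t) (U * R)"
        by (rule givens_product_Suc[OF U R])
    next
      fix i j assume "i < p" "j < k" "\<rho> i < \<rho> j"
      \<comment> \<open>Only \<open>j = h\<close> is affected. Then \<open>\<rho> i < t\<close>, so
        row \<open>i\<close> is zero in both rotated columns and stays so.\<close>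
      then show "(B * (U * R)) $$ (i, j) = 0"
        using h cols last unfolding assoc by (auto simp: idx)
    next
      fix i assume i: "i < p" "\<rho> i < Suc t"
      show "(B * (U * R)) $$ (i, k) = 0"
      proof (cases "\<rho> i = t")
        case True
        then have "i = h"
          using inj i h \<open>k \<le> p\<close> by (auto simp: inj_on_def)
        then show ?thesis
          using i h cs unfolding assoc by (auto simp: idx)
      next
        case False
        \<comment> \<open>Here \<open>\<rho> i < t = \<rho> h\<close>, so rows finished earlier are
          zero in both columns \<open>h\<close> and \<open>k\<close>, and the rotation creates no
          fill-in.\<close>
        then show ?thesis
          using i h cols last unfolding assoc by (auto simp: idx)
      qed
    qed
  qed
  from this[of k] that show ?thesis by auto
qed

section \<open>Rank, one-sided inverses and column spaces\<close>

text \<open>A maximal independent set of columns has \<open>n\<close> elements and is therefore a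
  basis, so every unit vector has a preimage under \<open>A\<close>; these preimages are the columns
  of \<open>R\<close>.\<close>

lemma (in vec_space) full_rank_right_inverse:
  assumes A: "A \<in> carrier_mat n nc" and rank: "rank A = n"
  obtains R where "R \<in> carrier_mat nc n" "A * R = 1\<^sub>m n"
proof -
  have cols: "set (cols A) \<subseteq> carrier_vec n" using A cols_dim by blast
  obtain S where S: "finite S" "maximal S (\<lambda>T. T \<subseteq> set (cols A) \<and> lin_indpt T)"
    using maximal_exists_superset[of "set (cols A)" "\<lambda>T. T \<subseteq> set (cols A) \<and> lin_indpt T" "{}"]
    by (auto simp: lin_dep_def)
  then have S': "S \<subseteq> set (cols A)" "lin_indpt S" by (auto simp: maximal_def)
  have "card S = n" using rank_card_indpt[OF A S(2)] rank by simp
  then have "basis S"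
    using dim_li_is_basis[of S] S S' cols dim_is_n by auto
  then have "carrier_vec n \<subseteq> col_space A"
    using span_is_monotone[OF S'(1)] by (auto simp: basis_def col_space_def)
  then have "\<forall>i. \<exists>x. i < n \<longrightarrow> x \<in> carrier_vec nc \<and> A *\<^sub>v x = unit_vec n i"
    unfolding col_space_eq[OF A] using A unit_vec_carrier[of n] by (auto simp: subset_eq)
  then obtain f where f: "\<And>i. i < n \<Longrightarrow> f i \<in> carrier_vec nc"
    "\<And>i. i < n \<Longrightarrow> A *\<^sub>v f i = unit_vec n i" by metis
  define R where "R = mat_of_cols nc (map f [0..<n])"
  have R: "R \<in> carrier_mat nc n" by (simp add: R_def mat_of_cols_def)
  moreover have "A * R = 1\<^sub>m n"
  proof (rule mat_col_eqI)
    fix i assume "i < dim_col (1\<^sub>m n :: 'a mat)"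
    then have i: "i < n" by simp
    then have "col R i = f i" using f by (simp add: R_def)
    then show "col (A * R) i = col (1\<^sub>m n) i"
      using col_mult2[OF A R i] f i by simp
  qed (use A R in auto)
  ultimately show ?thesis by (rule that)
qed

lemma (in vec_space) rank_left_invertible:
  assumes Q: "Q \<in> carrier_mat n k" and L: "L \<in> carrier_mat k n" "L * Q = 1\<^sub>m k"
  shows "rank Q = k"
proof (rule lin_indpt_full_rank[OF Q])
  have inj: "v = 0\<^sub>v k" if "v \<in> carrier_vec k" "Q *\<^sub>v v = 0\<^sub>v n" for v
  proof -
    have "v = (L * Q) *\<^sub>v v" using that L by simp
    also have "\<dots> = L *\<^sub>v (Q *\<^sub>v v)" using assoc_mult_mat_vec[OF L(1) Q that(1)] .
    also have "\<dots> = 0\<^sub>v k" using that L Q by auto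
    finally show ?thesis .
  qed
  \<comment> \<open>Independence is stated for the set of columns, which forgets repetitions, so
    equal columns are excluded separately: \<open>L\<close> would send them to equal unit
    vectors.\<close>
  show dist: "distinct (cols Q)"
    unfolding distinct_conv_nth
  proof (intro allI impI notI)
    fix i j assume ij: "i < length (cols Q)" "j < length (cols Q)" "i \<noteq> j" "cols Q ! i = cols Q ! j"
    then have "i < k" "j < k" "col Q i = col Q j" using Q by auto
    have "unit_vec k i = col (L * Q) i" using L \<open>i < k\<close> by simp
    also have "\<dots> = col (L * Q) j"
      using col_mult2[OF L(1) Q] \<open>i < k\<close> \<open>j < k\<close> \<open>col Q i = col Q j\<close> by simp
    also have "\<dots> = unit_vec k j" using L \<open>j < k\<close> by simp
    finally show False using \<open>i < k\<close> \<open>j < k\<close> \<open>i \<noteq> j\<close> by (metis unit_vec_eq)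
  qed
  show "lin_indpt (set (cols Q))"
    using lin_depE[OF Q _ dist] inj by metis
qed

text \<open>Each factorization gives one inclusion of column spaces, and the rank depends on the
  column space only.\<close>

lemma (in vec_space) rank_eq_of_mutual_factors:
  assumes A: "A \<in> carrier_mat n a" and Q: "Q \<in> carrier_mat n q"
    and M: "M \<in> carrier_mat q a" "A = Q * M" and N: "N \<in> carrier_mat a q" "Q = A * N"
  shows "rank A = rank Q"
proof -
  have sub: "col_space (B * C) \<subseteq> col_space B" if "B \<in> carrier_mat n b" "C \<in> carrier_mat b c" for B C b c
    using that by (auto simp: col_space_eq[OF that(1)] col_space_eq[OF mult_carrier_mat[OF that]]
        intro!: bexI[of _ "C *\<^sub>v _"])
  have "col_space A = col_space Q"
    using sub[OF A N(1)] sub[OF Q M(1)] unfolding M(2)[symmetric] N(2)[symmetric] by simp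
  then show ?thesis by (simp add: rank_def col_space_def)
qed

section \<open>Leading columns and orthonormality\<close>

lemma first_cols_carrier:
  assumes "A \<in> carrier_mat a b" and "k \<le> b"
  shows "first_cols A k \<in> carrier_mat a k"
  using assms by (auto simp: first_cols_def)

lemma col_first_cols:
  assumes "A \<in> carrier_mat a b" and "k \<le> b" and "j < k"
  shows "col (first_cols A k) j = col A j"
  using assms unfolding first_cols_def by (subst col_mat_of_cols) auto

lemma first_cols_index:
  assumes "A \<in> carrier_mat a b" and "k \<le> b" and "i < a" "j < k"
  shows "first_cols A k $$ (i, j) = A $$ (i, j)"
  using assms by (simp add: first_cols_def mat_of_cols_index)

lemma mult_first_cols:
  assumes B: "B \<in> carrier_mat p a" and A: "A \<in> carrier_mat a b" and "k \<le> b"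
  shows "B * first_cols A k = first_cols (B * A) k"
proof -
  have BA: "B * A \<in> carrier_mat p b" using B A by simp
  note F = first_cols_carrier[OF A \<open>k \<le> b\<close>] first_cols_carrier[OF BA \<open>k \<le> b\<close>]
  show ?thesis
  proof (rule mat_col_eqI)
    fix j assume "j < dim_col (first_cols (B * A) k)"
    then have "j < k" using F by simp
    then show "col (B * first_cols A k) j = col (first_cols (B * A) k) j"
      using \<open>k \<le> b\<close> col_mult2[OF B F(1), of j] col_mult2[OF B A, of j]
      by (simp add: col_first_cols[OF A] col_first_cols[OF BA])
  qed (use B F in auto)
qed

lemma orthonormal_first_cols:
  assumes V: "V \<in> carrier_mat a b" and "orthonormal_cols V" and "k \<le> b"
  shows "orthonormal_cols (first_cols V k)"
proof -
  have F: "first_cols V k \<in> carrier_mat a k" using first_cols_carrier V \<open>k \<le> b\<close> .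
  have "(first_cols V k)\<^sup>T * first_cols V k = 1\<^sub>m k"
  proof (rule eq_matI)
    fix i j assume "i < dim_row (1\<^sub>m k :: real mat)" "j < dim_col (1\<^sub>m k :: real mat)"
    then have ij: "i < k" "j < k" by auto
    then have "((first_cols V k)\<^sup>T * first_cols V k) $$ (i, j) = (V\<^sup>T * V) $$ (i, j)"
      using F V \<open>k \<le> b\<close> by (simp add: col_first_cols[OF V])
    also have "\<dots> = 1\<^sub>m b $$ (i, j)"
      using assms(1,2) by (simp add: orthonormal_cols_def)
    finally show "((first_cols V k)\<^sup>T * first_cols V k) $$ (i, j) = 1\<^sub>m k $$ (i, j)"
      using ij \<open>k \<le> b\<close> by simp
  qed (use F in auto)
  then show ?thesis using F by (simp add: orthonormal_cols_def)
qed

text \<open>The dropped columns of \<open>C\<close> are zero, so truncating both factors removes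
  only zero terms from each inner product. With \<open>C = B * U\<close> and \<open>U\<close>
  orthogonal this recovers \<open>B\<close> from the leading columns.\<close>

lemma first_cols_mult_transpose:
  assumes C: "C \<in> carrier_mat p N" and U: "U \<in> carrier_mat a N" and "r \<le> N"
    and zero: "\<And>i j. i < p \<Longrightarrow> r \<le> j \<Longrightarrow> j < N \<Longrightarrow> C $$ (i, j) = 0"
  shows "first_cols C r * (first_cols U r)\<^sup>T = C * U\<^sup>T"
proof (rule eq_matI)
  note F = first_cols_carrier[OF C \<open>r \<le> N\<close>] first_cols_carrier[OF U \<open>r \<le> N\<close>]
  fix i j assume "i < dim_row (C * U\<^sup>T)" "j < dim_col (C * U\<^sup>T)"
  then have ij: "i < p" "j < a" using C U by auto
  have "(first_cols C r * (first_cols U r)\<^sup>T) $$ (i, j) = (\<Sum>h \<in> {0..<r}. C $$ (i, h) * U $$ (j, h))"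
    using ij F \<open>r \<le> N\<close>
    by (simp add: scalar_prod_def first_cols_index[OF C] first_cols_index[OF U])
  also have "\<dots> = (\<Sum>h \<in> {0..<N}. C $$ (i, h) * U $$ (j, h))"
    using \<open>r \<le> N\<close> ij zero by (intro sum.mono_neutral_left) auto
  also have "\<dots> = (C * U\<^sup>T) $$ (i, j)"
    using ij C U by (simp add: scalar_prod_def)
  finally show "(first_cols C r * (first_cols U r)\<^sup>T) $$ (i, j) = (C * U\<^sup>T) $$ (i, j)" .
qed (use C U in \<open>auto simp: first_cols_def\<close>)

lemma orthonormal_mult:
  assumes A: "A \<in> carrier_mat a b" "orthonormal_cols A"
    and B: "B \<in> carrier_mat b c" "orthonormal_cols B"
  shows "orthonormal_cols (A * B)"
proof -
  have "(A * B)\<^sup>T * (A * B) = B\<^sup>T * (A\<^sup>T * A * B)"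
    using A(1) B(1)
    by (simp add: transpose_mult[OF A(1) B(1)] assoc_mult_mat[of _ c b _ a _ c] assoc_mult_mat[of _ b a _ b _ c])
  also have "\<dots> = 1\<^sub>m c"
    using A B by (simp add: orthonormal_cols_def)
  finally show ?thesis using B(1) by (simp add: orthonormal_cols_def)
qed

section \<open>Bordered matrices\<close>

lemma append_col_eq_four_block:
  assumes "A \<in> carrier_mat p q" and "g \<in> carrier_vec p"
  shows "append_col A g = four_block_mat A (mat_of_cols p [g]) (0\<^sub>m 0 q) (0\<^sub>m 0 1)"
  by (rule eq_matI) (use assms in \<open>auto simp: append_col_def mat_of_cols_index nth_append\<close>)

text \<open>Giving the bottom blocks height 1 or 0 according to the sign of \<gamma> unites both
  cases of the definition, so that later block computations need no case distinction.\<close>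

lemma border_eq_four_block:
  assumes "A \<in> carrier_mat p q" and "g \<in> carrier_vec p"
  shows "border A g \<gamma> = four_block_mat A (mat_of_cols p [g])
    (0\<^sub>m (of_bool (\<gamma> > 0)) q) (mat (of_bool (\<gamma> > 0)) 1 (\<lambda>_. \<gamma>))"
proof (cases "\<gamma> > 0")
  case True
  then show ?thesis using assms by (simp add: border_def)
next
  case False
  have "mat 0 1 (\<lambda>_. \<gamma>) = 0\<^sub>m 0 1" by (rule eq_matI) auto
  with False show ?thesis using assms by (simp add: border_def append_col_eq_four_block)
qed

lemma border_carrier:
  assumes "A \<in> carrier_mat p q" and "g \<in> carrier_vec p"
  shows "border A g \<gamma> \<in> carrier_mat (p + of_bool (\<gamma> > 0)) (q + 1)"
  unfolding border_eq_four_block[OF assms] using assms by (auto simp del: of_bool_eq_0_iff)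

text \<open>The factor \<open>diag(Q, 1)\<close> leaves the new column and the bottom row's last
  entry alone and depends neither on \<open>g\<close> nor on \<gamma>. One such factor therefore
  serves X and Y, even if only one of the two distances is positive.\<close>

lemma border_mult:
  assumes A: "A \<in> carrier_mat p q" and Q: "Q \<in> carrier_mat q s" and g: "g \<in> carrier_vec p"
  shows "border (A * Q) g \<gamma> = border A g \<gamma> * four_block_mat Q (0\<^sub>m q 1) (0\<^sub>m 1 s) (1\<^sub>m 1)"
proof -
  define e :: nat where "e = of_bool (\<gamma> > 0)"
  define v where "v = mat_of_cols p [g]"
  define w where "w = mat e 1 (\<lambda>_. \<gamma>)"
  have v: "v \<in> carrier_mat p 1" and w: "w \<in> carrier_mat e 1" by (auto simp: v_def w_def)
  have AQ: "A * Q \<in> carrier_mat p s" using A Q by simp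
  have "four_block_mat A v (0\<^sub>m e q) w * four_block_mat Q (0\<^sub>m q 1) (0\<^sub>m 1 s) (1\<^sub>m 1) =
      four_block_mat (A * Q + v * 0\<^sub>m 1 s) (A * 0\<^sub>m q 1 + v * 1\<^sub>m 1)
        (0\<^sub>m e q * Q + w * 0\<^sub>m 1 s) (0\<^sub>m e q * 0\<^sub>m q 1 + w * 1\<^sub>m 1)"
    by (rule mult_four_block_mat[OF A v zero_carrier_mat w Q]) auto
  also have "\<dots> = four_block_mat (A * Q) v (0\<^sub>m e s) w"
    using A Q AQ v w by simp
  finally show ?thesis
    unfolding border_eq_four_block[OF A g] border_eq_four_block[OF AQ g]
    by (simp only: e_def v_def w_def)
qed

lemma orthonormal_four_block_one:
  assumes Q: "Q \<in> carrier_mat q s" "orthonormal_cols Q"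
  shows "orthonormal_cols (four_block_mat Q (0\<^sub>m q 1) (0\<^sub>m 1 s) (1\<^sub>m 1))" (is "orthonormal_cols ?W")
proof -
  have T: "?W\<^sup>T = four_block_mat Q\<^sup>T (0\<^sub>m s 1) (0\<^sub>m 1 q) (1\<^sub>m 1)"
    using Q(1) by (subst transpose_four_block_mat) auto
  have "?W\<^sup>T * ?W = four_block_mat (Q\<^sup>T * Q) (0\<^sub>m s 1) (0\<^sub>m 1 s) (1\<^sub>m 1)"
    unfolding T using Q(1) by (subst mult_four_block_mat[of _ s q _ 1 _ 1]) auto
  also have "\<dots> = 1\<^sub>m (s + 1)"
    using Q by (simp add: orthonormal_cols_def)
  finally show ?thesis using Q(1) by (simp add: orthonormal_cols_def)
qed

lemma border_right_inverse:
  assumes A: "A \<in> carrier_mat p q" and R: "R \<in> carrier_mat q p" "A * R = 1\<^sub>m p"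
    and g: "g \<in> carrier_vec p"
  obtains S where "S \<in> carrier_mat (q + 1) (p + of_bool (\<gamma> > 0))"
    and "border A g \<gamma> * S = 1\<^sub>m (p + of_bool (\<gamma> > 0))"
proof -
  define e :: nat where "e = of_bool (\<gamma> > 0)"
  define v where "v = mat_of_cols p [g]"
  define w where "w = mat e 1 (\<lambda>_. \<gamma>)"
  \<comment> \<open>For \<open>e = 0\<close> this matrix has no columns, so the quotient occurs only
    when \<gamma> is positive.\<close>
  define u where "u = mat 1 e (\<lambda>_. 1 / \<gamma>)"
  have v: "v \<in> carrier_mat p 1" and w: "w \<in> carrier_mat e 1" and u: "u \<in> carrier_mat 1 e"
    by (auto simp: v_def w_def u_def)
  have wu: "w * u = 1\<^sub>m e"
    by (rule eq_matI) (auto simp: w_def u_def e_def scalar_prod_def of_bool_def split: if_splits)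
  have vu: "v * u \<in> carrier_mat p e" using v u by simp
  have "A * (R * (- (v * u))) = - (v * u)"
    using assoc_mult_mat[OF A R(1), of "- (v * u)" e] left_mult_one_mat[of "- (v * u)" p e] R(2) vu
    by simp
  then have top: "A * (R * (- (v * u))) + v * u = 0\<^sub>m p e"
    using vu by (simp add: uminus_l_inv_mat)
  have bot: "0\<^sub>m e q * (R * (- (v * u))) = 0\<^sub>m e e"
    by (rule left_mult_zero_mat) (use R(1) vu in simp)
  \<comment> \<open>The usual inverse of a block upper triangular matrix, with \<open>R\<close> in
    place of the inverse of \<open>A\<close>; the upper right block cancels
    \<open>v * u\<close>.\<close>
  define S where "S = four_block_mat R (R * (- (v * u))) (0\<^sub>m 1 p) u"
  have "four_block_mat A v (0\<^sub>m e q) w * S =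
      four_block_mat (A * R + v * 0\<^sub>m 1 p) (A * (R * (- (v * u))) + v * u)
        (0\<^sub>m e q * R + w * 0\<^sub>m 1 p) (0\<^sub>m e q * (R * (- (v * u))) + w * u)"
    unfolding S_def
    by (rule mult_four_block_mat[OF A v zero_carrier_mat w R(1) _ zero_carrier_mat u])
      (use R(1) vu in simp)
  also have "\<dots> = four_block_mat (1\<^sub>m p) (0\<^sub>m p e) (0\<^sub>m e p) (1\<^sub>m e)"
    unfolding top wu bot using R v w vu by simp
  also have "\<dots> = 1\<^sub>m (p + e)" by simp
  finally have "border A g \<gamma> * S = 1\<^sub>m (p + e)"
    unfolding border_eq_four_block[OF A g] by (simp only: e_def v_def w_def)
  moreover have "S \<in> carrier_mat (q + 1) (p + e)"
    unfolding S_def by (rule four_block_carrier_mat[OF R(1) u])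
  ultimately show ?thesis using that by (simp add: e_def)
qed

section \<open>One Gram-Schmidt step\<close>

lemma gs_dist_nonneg: "gs_dist Q x \<ge> 0"
  by (simp add: gs_dist_def norm2_def scalar_prod_def sum_nonneg)

lemma gs_coeffs_carrier: "Q \<in> carrier_mat m k \<Longrightarrow> gs_coeffs Q x \<in> carrier_vec k"
  by (rule carrier_vecI) (simp add: gs_coeffs_def)

lemma gram_schmidt_step:
  assumes Q: "Q \<in> carrier_mat m k" "orthonormal_cols Q" and A: "A \<in> carrier_mat k n"
    and x: "x \<in> carrier_vec m"
  defines "\<gamma> \<equiv> gs_dist Q x"
  obtains Q' where "Q' \<in> carrier_mat m (k + of_bool (\<gamma> > 0))" and "orthonormal_cols Q'"
    and "append_col (Q * A) x = Q' * border A (gs_coeffs Q x) \<gamma>"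
proof -
  define e :: nat where "e = of_bool (\<gamma> > 0)"
  define g where "g = gs_coeffs Q x"
  define y where "y = x - Q *\<^sub>v g"
  have g: "g \<in> carrier_vec k" using gs_coeffs_carrier[OF Q(1)] by (simp add: g_def)
  have y: "y \<in> carrier_vec m" using x Q(1) g by (simp add: y_def)
  have yy: "y \<bullet> y = \<gamma> * \<gamma>"
    using y by (simp add: \<gamma>_def gs_dist_def norm2_def g_def y_def scalar_prod_def sum_nonneg)
  have "Q\<^sup>T *\<^sub>v y = Q\<^sup>T *\<^sub>v x - Q\<^sup>T *\<^sub>v (Q *\<^sub>v g)"
    unfolding y_def by (rule mult_minus_distrib_mat_vec) (use Q(1) x g in auto)
  also have "Q\<^sup>T *\<^sub>v (Q *\<^sub>v g) = (Q\<^sup>T * Q) *\<^sub>v g"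
    by (rule assoc_mult_mat_vec[symmetric]) (use Q(1) g in auto)
  also have "\<dots> = g" using Q g by (simp add: orthonormal_cols_def)
  finally have Qy: "Q\<^sup>T *\<^sub>v y = 0\<^sub>v k"
    using g by (simp add: g_def gs_coeffs_def)
  \<comment> \<open>The normalised residual as a matrix with \<open>e\<close> columns: empty when
    \<gamma> is zero, so nothing is then appended to \<open>Q\<close>.\<close>
  define q where "q = mat m e (\<lambda>(i, _). y $ i / \<gamma>)"
  define v where "v = mat_of_cols k [g]"
  define w where "w = mat e 1 (\<lambda>_. \<gamma>)"
  have q: "q \<in> carrier_mat m e" and v: "v \<in> carrier_mat k 1" and w: "w \<in> carrier_mat e 1"
    by (auto simp: q_def v_def w_def)
  define Q' where "Q' = four_block_mat Q q (0\<^sub>m 0 k) (0\<^sub>m 0 e)"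
  have "Q' * four_block_mat A v (0\<^sub>m e n) w =
      four_block_mat (Q * A + q * 0\<^sub>m e n) (Q * v + q * w)
        (0\<^sub>m 0 k * A + 0\<^sub>m 0 e * 0\<^sub>m e n) (0\<^sub>m 0 k * v + 0\<^sub>m 0 e * w)"
    unfolding Q'_def
    by (rule mult_four_block_mat[OF Q(1) q zero_carrier_mat zero_carrier_mat A v zero_carrier_mat w])
  moreover have "Q * v + q * w = mat_of_cols m [x]"
  proof (rule eq_matI)
    fix i j assume "i < dim_row (mat_of_cols m [x])" "j < dim_col (mat_of_cols m [x])"
    then have i: "i < m" and [simp]: "j = 0" by auto
    have [simp]: "col v 0 = g" using g by (simp add: v_def)
    \<comment> \<open>For positive \<gamma> the scaling by \<gamma> undoes the normalisation.
      Otherwise the product is an empty sum, and \<open>y\<close> vanishes because its squared norm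
      is zero.\<close>
    have "(q * w) $$ (i, 0) = y $ i"
    proof (cases "\<gamma> > 0")
      case True
      then show ?thesis using i by (simp add: q_def w_def e_def scalar_prod_def)
    next
      case False
      then have "y \<bullet> y = 0" using gs_dist_nonneg[of Q x] yy by (simp add: \<gamma>_def)
      then have "y $ i = 0" using y i by (simp add: scalar_prod_def sum_nonneg_eq_0_iff)
      then show ?thesis using i False by (simp add: q_def w_def e_def scalar_prod_def)
    qed
    then show "(Q * v + q * w) $$ (i, j) = mat_of_cols m [x] $$ (i, j)"
      using i Q(1) v q w x g by (simp add: y_def mat_of_cols_Cons_index_0)
  qed (use Q(1) q v w in auto)
  ultimately have "Q' * four_block_mat A v (0\<^sub>m e n) w = append_col (Q * A) x"
    unfolding append_col_eq_four_block[OF mult_carrier_mat[OF Q(1) A] x]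
    using Q(1) A q v w by simp
  then have "Q' * border A g \<gamma> = append_col (Q * A) x"
    unfolding border_eq_four_block[OF A g] by (simp only: e_def v_def w_def)
  moreover have "Q' \<in> carrier_mat m (k + e)"
    unfolding Q'_def using four_block_carrier_mat[OF Q(1), of "0\<^sub>m 0 e" 0 e] by simp
  moreover have "orthonormal_cols Q'"
  proof -
    \<comment> \<open>The four blocks of the Gram matrix of \<open>(Q q)\<close> are computed
      separately; the mixed ones vanish because the residual \<open>y\<close> is orthogonal to the
      columns of \<open>Q\<close>.\<close>
    have QTq: "Q\<^sup>T * q = 0\<^sub>m k e"
    proof (rule eq_matI)
      fix i j assume "i < dim_row (0\<^sub>m k e :: real mat)" "j < dim_col (0\<^sub>m k e :: real mat)"
      then have ij: "i < k" "j < e" by auto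
      have "(Q\<^sup>T * q) $$ (i, j) = (Q\<^sup>T *\<^sub>v y) $ i / \<gamma>"
        using ij Q(1) y by (simp add: q_def scalar_prod_def sum_divide_distrib)
      then show "(Q\<^sup>T * q) $$ (i, j) = 0\<^sub>m k e $$ (i, j)" using Qy ij by simp
    qed (use Q(1) q in auto)
    have "q\<^sup>T * Q = (Q\<^sup>T * q)\<^sup>T" using transpose_mult[of "Q\<^sup>T" k m q e] Q(1) q by simp
    then have qTQ: "q\<^sup>T * Q = 0\<^sub>m e k" using QTq by simp
    have qTq: "q\<^sup>T * q = 1\<^sub>m e"
    proof (rule eq_matI)
      fix i j assume "i < dim_row (1\<^sub>m e :: real mat)" "j < dim_col (1\<^sub>m e :: real mat)"
      then have ij: "i < e" "j < e" by auto
      then have [simp]: "i = 0" "j = 0" "\<gamma> > 0" by (auto simp: e_def of_bool_def split: if_splits)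
      have "(q\<^sup>T * q) $$ (i, j) = y \<bullet> y / (\<gamma> * \<gamma>)"
        using ij y by (simp add: q_def scalar_prod_def sum_divide_distrib)
      then show "(q\<^sup>T * q) $$ (i, j) = 1\<^sub>m e $$ (i, j)"
        using ij yy \<open>\<gamma> > 0\<close> by simp
    qed (use q in auto)
    have "Q'\<^sup>T = four_block_mat Q\<^sup>T (0\<^sub>m k 0) q\<^sup>T (0\<^sub>m e 0)"
      unfolding Q'_def
      using transpose_four_block_mat[OF Q(1) q, of "0\<^sub>m 0 k" 0 "0\<^sub>m 0 e"] by simp
    then have "Q'\<^sup>T * Q' = four_block_mat (Q\<^sup>T * Q + 0\<^sub>m k 0 * 0\<^sub>m 0 k) (Q\<^sup>T * q + 0\<^sub>m k 0 * 0\<^sub>m 0 e)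
        (q\<^sup>T * Q + 0\<^sub>m e 0 * 0\<^sub>m 0 k) (q\<^sup>T * q + 0\<^sub>m e 0 * 0\<^sub>m 0 e)"
      unfolding Q'_def
      by (simp only:, intro mult_four_block_mat[of _ k m _ 0 _ e]) (use Q(1) q in auto)
    also have "\<dots> = 1\<^sub>m (k + e)"
      using Q by (simp add: QTq qTQ qTq orthonormal_cols_def)
    finally show ?thesis
      using \<open>Q' \<in> carrier_mat m (k + e)\<close> by (simp add: orthonormal_cols_def)
  qed
  ultimately show ?thesis using that[of Q'] by (simp add: e_def g_def)
qed

section \<open>Triangularising the bordered factor\<close>

lemma givens_triangularisation:
  fixes \<gamma> :: real
  assumes T: "T \<in> carrier_mat k k" "triangular ft T" and g: "g \<in> carrier_vec k"
  defines "r \<equiv> k + of_bool (\<gamma> > 0)"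
  obtains U where "givens_product (k + 1) k U" and "ft = RQ \<and> \<gamma> > 0 \<longrightarrow> U = 1\<^sub>m (k + 1)"
    and "triangular ft (first_cols (border T g \<gamma> * U) r)"
    and "\<And>i j. i < r \<Longrightarrow> r \<le> j \<Longrightarrow> j < k + 1 \<Longrightarrow> (border T g \<gamma> * U) $$ (i, j) = 0"
proof -
  define B where "B = border T g \<gamma>"
  have B: "B \<in> carrier_mat r (k + 1)"
    using border_carrier[OF T(1) g] by (simp add: B_def r_def)
  have Bidx: "B $$ (i, j) = (if i < k then T $$ (i, j) else 0)" if "i < r" "j < k" for i j
    using that T(1) unfolding B_def border_eq_four_block[OF T(1) g] r_def by auto
  have r: "r \<le> k + 1" "k \<le> r" by (auto simp: r_def)
  have idx: "first_cols (B * U) r $$ (i, j) = (B * U) $$ (i, j)"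
    and dim: "first_cols (B * U) r \<in> carrier_mat r r"
    if "givens_product (k + 1) k U" "i < r" "j < r" for U i j
    using first_cols_index[of "B * U" r "k + 1" r i j] first_cols_carrier[of "B * U" r "k + 1" r]
      B givens_product_carrier[OF that(1)] r that by auto
  consider (RQ_full) "ft = RQ" "\<gamma> > 0" | (RQ_low) "ft = RQ" "\<not> \<gamma> > 0" | (LQ) "ft = LQ"
    by (cases ft) auto
  then show ?thesis
  proof cases
    case RQ_full
    \<comment> \<open>The bordered matrix is already upper triangular and \<open>r = k + 1\<close>,
      so no column is dropped and the vanishing condition is vacuous.\<close>
    have U: "givens_product (k + 1) k (1\<^sub>m (k + 1))" by (rule givens_product_one) simp
    have "upper_triangular (first_cols (B * 1\<^sub>m (k + 1)) r)"
    proof (intro upper_triangularI)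
      fix i j assume "j < i" "i < dim_row (first_cols (B * 1\<^sub>m (k + 1)) r)"
      then have "i < r" "j < k" "j < r" using B r(1) by (auto simp: first_cols_def)
      then show "first_cols (B * 1\<^sub>m (k + 1)) r $$ (i, j) = 0"
        using idx[OF U, of i j] B T RQ_full \<open>j < i\<close> by (auto simp: Bidx upper_triangular_def)
    qed
    then show ?thesis
      using that[of "1\<^sub>m (k + 1)"] U RQ_full by (simp add: B_def r_def)
  next
    case RQ_low
    then have [simp]: "r = k" by (simp add: r_def)
    \<comment> \<open>For indices below \<open>k\<close>, \<open>\<rho> i < \<rho> j\<close> means
      \<open>j < i\<close>, so the zero pattern is upper triangularity. Since \<open>r = k\<close>,
      truncated subtraction is injective on all rows.\<close>
    define \<rho> where "\<rho> i = k - 1 - i" for i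
    obtain U where U: "givens_product (k + 1) k U"
      and cols: "\<And>i j. i < r \<Longrightarrow> j < k \<Longrightarrow> \<rho> i < \<rho> j \<Longrightarrow> (B * U) $$ (i, j) = 0"
      and last: "\<And>i. i < r \<Longrightarrow> \<rho> i < k \<Longrightarrow> (B * U) $$ (i, k) = 0"
    proof (rule givens_elimination[OF B, of \<rho>])
      show "inj_on \<rho> {..<r}" by (auto simp: \<rho>_def inj_on_def)
      show "{..<k} \<subseteq> \<rho> ` {..<k}"
      proof
        fix t assume "t \<in> {..<k}"
        then show "t \<in> \<rho> ` {..<k}" by (intro image_eqI[of _ _ "k - 1 - t"]) (auto simp: \<rho>_def)
      qed
      show "B $$ (i, j) = 0" if "i < r" "j < k" "\<rho> i < \<rho> j" for i j
        using that T RQ_low by (auto simp: Bidx \<rho>_def upper_triangular_def)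
    qed auto
    have "upper_triangular (first_cols (B * U) r)"
    proof (intro upper_triangularI)
      fix i j assume "j < i" "i < dim_row (first_cols (B * U) r)"
      then have "i < k" using B by (simp add: first_cols_def)
      with \<open>j < i\<close> show "first_cols (B * U) r $$ (i, j) = 0"
        using idx[OF U, of i j] cols[of i j] by (simp add: \<rho>_def)
    qed
    moreover have "(B * U) $$ (i, j) = 0" if "i < r" "r \<le> j" "j < k + 1" for i j
      using last[of i] that by (simp add: \<rho>_def less_Suc_eq_le)
    ultimately show ?thesis
      using that[of U] U RQ_low by (simp add: B_def)
  next
    case LQ
    \<comment> \<open>If \<gamma> is positive there is an additional row \<open>k\<close>. Its last
      entry need not be annihilated: it lies on the diagonal, and column \<open>k\<close> is kept
      because \<open>r = k + 1\<close>.\<close>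
    obtain U where U: "givens_product (k + 1) k U"
      and cols: "\<And>i j. i < r \<Longrightarrow> j < k \<Longrightarrow> i < j \<Longrightarrow> (B * U) $$ (i, j) = 0"
      and last: "\<And>i. i < r \<Longrightarrow> i < k \<Longrightarrow> (B * U) $$ (i, k) = 0"
      by (rule givens_elimination[OF B r(2), of "\<lambda>i. i"])
        (use T LQ in \<open>auto simp: Bidx lower_triangular_def\<close>)
    have "lower_triangular (first_cols (B * U) r)"
      unfolding lower_triangular_def
    proof (intro allI impI)
      fix i j assume "i < j" "j < dim_col (first_cols (B * U) r)"
      then have "j < r" "i < k" "i < r"
        using B r givens_product_carrier[OF U] by (auto simp: first_cols_def)
      then show "first_cols (B * U) r $$ (i, j) = 0"
        using idx[OF U, of i j] cols[of i j] last[of i] \<open>i < j\<close> r by (cases "j = k") auto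
    qed
    moreover have "(B * U) $$ (i, j) = 0" if "i < r" "r \<le> j" "j < k + 1" for i j
      using last[of i] that r by (cases "j = k") auto
    ultimately show ?thesis
      using that[of U] U LQ by (simp add: B_def)
  qed
qed

section \<open>The rank of the extended matrix and the update\<close>

text \<open>Ties the truncation index to the sign of the distance. The full row rank of
  \<open>A\<close> makes the border right invertible, so the extended matrix and \<open>Q'\<close>
  are multiples of each other, and \<open>Q'\<close> has independent columns.\<close>

lemma rank_gram_schmidt_step:
  assumes Q: "Q \<in> carrier_mat m k" "orthonormal_cols Q"
    and A: "A \<in> carrier_mat k n" "full_row_rank A" and x: "x \<in> carrier_vec m"
  shows "vec_space.rank m (append_col (Q * A) x) = k + of_bool (gs_dist Q x > 0)"
proof -
  define \<gamma> where "\<gamma> = gs_dist Q x"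
  define g where "g = gs_coeffs Q x"
  define r where "r = k + of_bool (\<gamma> > 0)"
  have g: "g \<in> carrier_vec k" using gs_coeffs_carrier[OF Q(1)] by (simp add: g_def)
  obtain Q' where Q': "Q' \<in> carrier_mat m r" "orthonormal_cols Q'"
    and eq: "append_col (Q * A) x = Q' * border A g \<gamma>"
    using gram_schmidt_step[OF Q A(1) x] unfolding \<gamma>_def g_def r_def by metis
  obtain R where R: "R \<in> carrier_mat n k" "A * R = 1\<^sub>m k"
    using vec_space.full_rank_right_inverse[OF A(1)] A by (auto simp: full_row_rank_def)
  obtain S where S: "S \<in> carrier_mat (n + 1) r" "border A g \<gamma> * S = 1\<^sub>m r"
    using border_right_inverse[OF A(1) R g, of \<gamma>] unfolding r_def by metis
  have B: "border A g \<gamma> \<in> carrier_mat r (n + 1)"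
    using border_carrier[OF A(1) g] by (simp add: r_def)
  have X: "append_col (Q * A) x \<in> carrier_mat m (n + 1)"
    unfolding eq by (rule mult_carrier_mat[OF Q'(1) B])
  have "append_col (Q * A) x * S = Q'"
    using S Q'(1) unfolding eq assoc_mult_mat[OF Q'(1) B S(1)] by simp
  from vec_space.rank_eq_of_mutual_factors[OF X Q'(1) B eq S(1) this[symmetric]]
  have "vec_space.rank m (append_col (Q * A) x) = vec_space.rank m Q'" .
  also have "\<dots> = r"
    using vec_space.rank_left_invertible[OF Q'(1), of "Q'\<^sup>T"] Q' by (simp add: orthonormal_cols_def)
  finally show ?thesis by (simp add: r_def \<gamma>_def)
qed

theorem proposition3p3:
  fixes m n rx ry r :: nat
    and X Y Qx Qy Xt Yt Qt T G Xnew Ynew Xtnew Ytnew :: "real mat"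
    and xnew ynew gx gy :: "real vec"
    and \<gamma>x \<gamma>y :: real
    and ft :: fact_type
  assumes Qx: "Qx \<in> carrier_mat m rx" "orthonormal_cols Qx"
    and Qy: "Qy \<in> carrier_mat m ry" "orthonormal_cols Qy"
    and Xt: "Xt \<in> carrier_mat rx n" "full_row_rank Xt"
    and Yt: "Yt \<in> carrier_mat ry n" "full_row_rank Yt"
    and X: "X = Qx * Xt"
    and Y: "Y = Qy * Yt"
    and Qt: "Qt \<in> carrier_mat n rx" "orthonormal_cols Qt"
    and T: "T \<in> carrier_mat rx rx" "triangular ft T"
    and fact: "Xt = T * Qt\<^sup>T"
    and G: "G = Yt * Qt"
    and xnew: "xnew \<in> carrier_vec m"
    and ynew: "ynew \<in> carrier_vec m"
    and Xnew: "Xnew = append_col X xnew"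
    and Ynew: "Ynew = append_col Y ynew"
    and gx: "gx = gs_coeffs Qx xnew" and \<gamma>x: "\<gamma>x = gs_dist Qx xnew"
    and gy: "gy = gs_coeffs Qy ynew" and \<gamma>y: "\<gamma>y = gs_dist Qy ynew"
    and Xtnew: "Xtnew = border Xt gx \<gamma>x"
    and Ytnew: "Ytnew = border Yt gy \<gamma>y"
    and r: "r = vec_space.rank m Xnew"
  shows "r \<in> {rx, rx + 1} \<and>
    (\<exists>U. givens_product (rx + 1) rx U \<and>
         (ft = RQ \<and> \<gamma>x > 0 \<longrightarrow> U = 1\<^sub>m (rx + 1)) \<and>
         (let Tnew = border T gx \<gamma>x * first_cols U r;
              Gnew = border G gy \<gamma>y * first_cols U r
          in Tnew \<in> carrier_mat r r \<and> triangular ft Tnew \<and>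
             (\<exists>Qtnew \<in> carrier_mat (n + 1) r.
                orthonormal_cols Qtnew \<and> Xtnew = Tnew * Qtnew\<^sup>T \<and> Gnew = Ytnew * Qtnew)))"
proof -
  have gxc: "gx \<in> carrier_vec rx" and gyc: "gy \<in> carrier_vec ry"
    using Qx Qy gx gy gs_coeffs_carrier by auto
  have r_eq: "r = rx + of_bool (\<gamma>x > 0)"
    using rank_gram_schmidt_step[OF Qx Xt xnew] by (simp add: r Xnew X \<gamma>x)
  then have r_le: "r \<le> rx + 1" by simp
  define B where "B = border T gx \<gamma>x"
  have B: "B \<in> carrier_mat r (rx + 1)"
    using border_carrier[OF T(1) gxc] by (simp add: B_def r_eq)
  obtain U where U: "givens_product (rx + 1) rx U"
    and U_one: "ft = RQ \<and> \<gamma>x > 0 \<longrightarrow> U = 1\<^sub>m (rx + 1)"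
    and tri: "triangular ft (first_cols (B * U) r)"
    and zero: "\<And>i j. i < r \<Longrightarrow> r \<le> j \<Longrightarrow> j < rx + 1 \<Longrightarrow> (B * U) $$ (i, j) = 0"
    using givens_triangularisation[OF T gxc, of \<gamma>x] unfolding B_def r_eq by metis
  have Uc: "U \<in> carrier_mat (rx + 1) (rx + 1)" by (rule givens_product_carrier[OF U])
  have Uo: "orthonormal_cols U"
    using givens_product_orthogonal(1)[OF U] Uc by (simp add: orthonormal_cols_def)
  define U1 where "U1 = first_cols U r"
  have U1: "U1 \<in> carrier_mat (rx + 1) r"
    unfolding U1_def by (rule first_cols_carrier[OF Uc r_le])
  have BU1: "B * U1 = first_cols (B * U) r"
    unfolding U1_def by (rule mult_first_cols[OF B Uc r_le])
  have BU: "B * U \<in> carrier_mat r (rx + 1)" using B Uc by simp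
  define W where "W = four_block_mat Qt (0\<^sub>m n 1) (0\<^sub>m 1 rx) (1\<^sub>m 1)"
  have W: "W \<in> carrier_mat (n + 1) (rx + 1)" "orthonormal_cols W"
    using Qt orthonormal_four_block_one[OF Qt] by (auto simp: W_def)
  have WT: "W\<^sup>T = four_block_mat Qt\<^sup>T (0\<^sub>m rx 1) (0\<^sub>m 1 n) (1\<^sub>m 1)"
    unfolding W_def using Qt(1) by (subst transpose_four_block_mat) auto
  \<comment> \<open>\<open>U1 * U1\<^sup>T\<close> need not be the identity, but it acts as one on
    the right of \<open>B\<close>, because the columns dropped from \<open>B * U\<close> are
    zero.\<close>
  have "B * U1 * U1\<^sup>T = B * U * U\<^sup>T"
    using first_cols_mult_transpose[OF BU Uc r_le zero]
    by (simp only: U1_def[symmetric] BU1[symmetric])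
  also have "\<dots> = B"
    using B Uc givens_product_orthogonal(2)[OF U]
    by (simp add: assoc_mult_mat[of B r "rx + 1" U "rx + 1" _ "rx + 1"])
  finally have BUU: "B * U1 * U1\<^sup>T = B" .
  have "Xtnew = B * W\<^sup>T"
    using border_mult[OF T(1), of "Qt\<^sup>T" n gx \<gamma>x] Qt(1) gxc by (simp add: Xtnew fact B_def WT)
  also have "\<dots> = B * U1 * (W * U1)\<^sup>T"
    using BUU B U1 W(1)
    by (simp add: transpose_mult[OF W(1) U1]
        assoc_mult_mat[of "B * U1" r r "U1\<^sup>T" "rx + 1" "W\<^sup>T" "n + 1", symmetric])
  finally have "Xtnew = B * U1 * (W * U1)\<^sup>T" .
  \<comment> \<open>This half is associativity after \<open>border_mult\<close>; it uses no relation
    between \<open>Yt\<close> and \<open>U1\<close>.\<close>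
  moreover have "border G gy \<gamma>y * U1 = Ytnew * (W * U1)"
    unfolding G Ytnew border_mult[OF Yt(1) Qt(1) gyc] W_def[symmetric]
    by (rule assoc_mult_mat[OF border_carrier[OF Yt(1) gyc] W(1) U1])
  moreover have "orthonormal_cols (W * U1)"
    unfolding U1_def by (rule orthonormal_mult[OF W first_cols_carrier[OF Uc r_le]
      orthonormal_first_cols[OF Uc Uo r_le]])
  moreover have "W * U1 \<in> carrier_mat (n + 1) r" "B * U1 \<in> carrier_mat r r"
    using W(1) B U1 by auto
  moreover have "triangular ft (B * U1)" using tri by (simp only: BU1)
  moreover have "r \<in> {rx, rx + 1}" using r_eq by simp
  ultimately show ?thesis
    unfolding Let_def B_def[symmetric] using U U_one
    by (intro conjI exI[of _ U] bexI[of _ "W * U1"]) (simp_all only: U1_def[symmetric])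
qed

end
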